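(* Let $\mathbb{A}=(A,\vee,\wedge,c,0,1)$ be a semisimple Nelson algebra whose underlying lattice $A$ is algebraic. Then there exist a set $U$ and an equivalence relation $R$ on $U$ such that $\mathbb{A}\cong\mathbb{RS}$, where $\mathbb{RS}$ is the algebra of rough sets determined by $R$.
   Context: Algebraic lattice: a complete lattice in which every element is a join of compact elements. A De Morgan algebra $(A,\vee,\wedge,c,0,1)$ is a bounded distributive lattice with least element $0$ and greatest element $1$, with a unary operation $c$ such that for all $x,y\in A$: $c(c(x))=x$, and $x\le y$ iff $c(x)\ge c(y)$. A Kleene algebra is a De Morgan algebra with $x\wedge c(x)\le y\vee c(y)$ for all $x,y$. For elements $a,b$ of a lattice, the relative pseudocomplement $a\Rightarrow b$ is the greatest $x$ with $a\wedge x\le b$ (if it exists). A quasi-Nelson algebra is a Kleene algebra in which $a\Rightarrow(c(a)\vee b)$ exists for all $a,b$; one writes $a\to b$ for $a\Rightarrow(c(a)\vee b)$. A Nelson algebra is a quasi-Nelson algebra satisfying $(a\wedge b)\to d=a\to(b\to d)$ for all $a,b,d$. Nelson algebras can equivalently be regarded as algebras $(A,\vee,\wedge,\to,c,0,1)$ and form an equational class in this signature. A Nelson algebra is semisimple (in the usual sense of universal algebra) if, as an algebra $(A,\vee,\wedge,\to,c,0,1)$, it is isomorphic to a subdirect product of simple Nelson algebras. It is known that semisimple Nelson algebras coincide with three-valued {\L}ukasiewicz algebras, i.e. algebras $(A,\vee,\wedge,c,\Delta,1)$ such that $A$ is a distributive lattice (with greatest element $1$) and for all $x,y\in A$: $c(c(x))=x$;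 $c(x\wedge y)=c(x)\vee c(y)$; $c(x)\vee\Delta(x)=1$; $x\wedge c(x)=c(x)\wedge\Delta(x)$; $\Delta(x\wedge y)=\Delta(x)\wedge\Delta(y)$. Rough sets: for a binary relation $R$ on $U$, put $R(x)=\{y\in U\mid x\,R\,y\}$, and for $X\subseteq U$ put $X^{\blacktriangledown}=\{x\in U\mid R(x)\subseteq X\}$, $X^{\blacktriangle}=\{x\in U\mid R(x)\cap X\ne\emptyset\}$, $\mathcal{A}(X)=(X^{\blacktriangledown},X^{\blacktriangle})$. Let $RS=\{\mathcal{A}(X)\mid X\subseteq U\}$, ordered by coordinatewise inclusion. When $R$ is reflexive and transitive (in particular, an equivalence), it is known that $RS$ is a complete sublattice of $\wp(U)\times\wp(U)$ (so joins and meets are coordinatewise unions and intersections), and that $\mathbb{RS}=(RS,\vee,\wedge,c,(\emptyset,\emptyset),(U,U))$ with $c(\mathcal{A}(X))=\mathcal{A}(U\setminus X)$ is a (well-defined) De Morgan algebra. The symbol $\cong$ denotes isomorphism of algebras with respect to $\vee,\wedge,c,0,1$ (hence also with respect to $\to$, which is determined by these). *)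

theory Defs
  imports "HOL-Algebra.Complete_Lattice"
begin

section \<open>De Morgan, Kleene and Nelson algebras\<close>

text \<open>
  An algebra with operations join, meet, c, 0, 1 is an ordered carrier together with a unary
  operation c; the lattice operations and the constants are those that \<^theory>\<open>HOL-Algebra.Lattice\<close>
  derives from the order (they are unique, because \<^locale>\<open>partial_order\<close> forces the
  equality of the record to be equality).
\<close>

record 'a dm_alg = "'a gorder" +
  cpl :: "'a \<Rightarrow> 'a" (\<open>\<c>\<index>\<close>)

locale de_morgan_algebra = bounded_lattice A for A :: "('a, 'm) dm_alg_scheme" (structure) +
  assumes distrib:
      "\<lbrakk>x \<in> carrier A; y \<in> carrier A; z \<in> carrier A\<rbrakk>
        \<Longrightarrow> x \<sqinter> (y \<squnion> z) = (x \<sqinter> y) \<squnion> (x \<sqinter> z)"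
    and cpl_closed: "x \<in> carrier A \<Longrightarrow> \<c> x \<in> carrier A"
    and cpl_cpl: "x \<in> carrier A \<Longrightarrow> \<c> (\<c> x) = x"
    and cpl_antitone: "\<lbrakk>x \<in> carrier A; y \<in> carrier A\<rbrakk> \<Longrightarrow> x \<sqsubseteq> y \<longleftrightarrow> \<c> y \<sqsubseteq> \<c> x"

locale kleene_algebra = de_morgan_algebra +
  assumes kleene:
    "\<lbrakk>x \<in> carrier A; y \<in> carrier A\<rbrakk> \<Longrightarrow> x \<sqinter> \<c> x \<sqsubseteq> y \<squnion> \<c> y"

definition is_rel_pseudocomplement :: "('a, 'm) gorder_scheme \<Rightarrow> 'a \<Rightarrow> 'a \<Rightarrow> 'a \<Rightarrow> bool" where
  "is_rel_pseudocomplement L a b r \<longleftrightarrow>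
     greatest L r {x \<in> carrier L. a \<sqinter>\<^bsub>L\<^esub> x \<sqsubseteq>\<^bsub>L\<^esub> b}"

definition nelson_imp :: "('a, 'm) dm_alg_scheme \<Rightarrow> 'a \<Rightarrow> 'a \<Rightarrow> 'a" where
  "nelson_imp A a b = (THE r. is_rel_pseudocomplement A a (\<c>\<^bsub>A\<^esub> a \<squnion>\<^bsub>A\<^esub> b) r)"

locale quasi_nelson_algebra = kleene_algebra +
  assumes rel_pseudocomplement_exists:
    "\<lbrakk>a \<in> carrier A; b \<in> carrier A\<rbrakk>
      \<Longrightarrow> \<exists>r. is_rel_pseudocomplement A a (\<c> a \<squnion> b) r"

locale nelson_algebra = quasi_nelson_algebra +
  assumes nelson:
    "\<lbrakk>a \<in> carrier A; b \<in> carrier A; d \<in> carrier A\<rbrakk>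
      \<Longrightarrow> nelson_imp A (a \<sqinter> b) d = nelson_imp A a (nelson_imp A b d)"


section \<open>Semisimplicity\<close>

text \<open>
  The universal-algebraic notions refer to the full signature with join, meet, implication,
  c, 0, 1, in which Nelson algebras form an equational class.
\<close>

record 'a nelson_sig = "'a partial_object" +
  op_join :: "'a \<Rightarrow> 'a \<Rightarrow> 'a"
  op_meet :: "'a \<Rightarrow> 'a \<Rightarrow> 'a"
  op_imp :: "'a \<Rightarrow> 'a \<Rightarrow> 'a"
  op_cpl :: "'a \<Rightarrow> 'a"
  op_zero :: 'a
  op_one :: 'a

definition nelson_sig_of :: "('a, 'm) dm_alg_scheme \<Rightarrow> 'a nelson_sig" where
  "nelson_sig_of A =
     \<lparr>carrier = carrier A,
      op_join = (\<lambda>x y. x \<squnion>\<^bsub>A\<^esub> y),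
      op_meet = (\<lambda>x y. x \<sqinter>\<^bsub>A\<^esub> y),
      op_imp = nelson_imp A,
      op_cpl = cpl A,
      op_zero = \<bottom>\<^bsub>A\<^esub>,
      op_one = \<top>\<^bsub>A\<^esub>\<rparr>"

definition congruence_on :: "('a, 'm) nelson_sig_scheme \<Rightarrow> 'a rel \<Rightarrow> bool" where
  "congruence_on S \<theta> \<longleftrightarrow>
     equiv (carrier S) \<theta> \<and>
     (\<forall>x x'. (x, x') \<in> \<theta> \<longrightarrow> (op_cpl S x, op_cpl S x') \<in> \<theta>) \<and>
     (\<forall>x x' y y'. (x, x') \<in> \<theta> \<and> (y, y') \<in> \<theta> \<longrightarrow>
        (op_join S x y, op_join S x' y') \<in> \<theta> \<and>
        (op_meet S x y, op_meet S x' y') \<in> \<theta> \<and>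
        (op_imp S x y, op_imp S x' y') \<in> \<theta>)"

text \<open>
  Simple: the diagonal and the full relation are the only congruences, and they differ, so
  the one-element algebra is not simple. It is nevertheless a subdirect product, namely of
  the empty family.
\<close>

definition simple_algebra :: "('a, 'm) nelson_sig_scheme \<Rightarrow> bool" where
  "simple_algebra S \<longleftrightarrow>
     Id_on (carrier S) \<noteq> carrier S \<times> carrier S \<and>
     {\<theta>. congruence_on S \<theta>} = {Id_on (carrier S), carrier S \<times> carrier S}"

definition direct_product :: "'i set \<Rightarrow> ('i \<Rightarrow> 'b nelson_sig) \<Rightarrow> ('i \<Rightarrow> 'b) nelson_sig" where
  "direct_product I B =
     \<lparr>carrier = (\<Pi>\<^sub>E i\<in>I. carrier (B i)),
      op_join = (\<lambda>f g. \<lambda>i\<in>I. op_join (B i) (f i) (g i)),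
      op_meet = (\<lambda>f g. \<lambda>i\<in>I. op_meet (B i) (f i) (g i)),
      op_imp = (\<lambda>f g. \<lambda>i\<in>I. op_imp (B i) (f i) (g i)),
      op_cpl = (\<lambda>f. \<lambda>i\<in>I. op_cpl (B i) (f i)),
      op_zero = (\<lambda>i\<in>I. op_zero (B i)),
      op_one = (\<lambda>i\<in>I. op_one (B i))\<rparr>"

definition subuniverse :: "'a set \<Rightarrow> ('a, 'm) nelson_sig_scheme \<Rightarrow> bool" where
  "subuniverse T S \<longleftrightarrow>
     T \<subseteq> carrier S \<and> op_zero S \<in> T \<and> op_one S \<in> T \<and>
     (\<forall>x\<in>T. op_cpl S x \<in> T) \<and>
     (\<forall>x\<in>T. \<forall>y\<in>T. op_join S x y \<in> T \<and> op_meet S x y \<in> T \<and> op_imp S x y \<in> T)"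

definition subdirect_product ::
  "('i \<Rightarrow> 'b) nelson_sig \<Rightarrow> 'i set \<Rightarrow> ('i \<Rightarrow> 'b nelson_sig) \<Rightarrow> bool" where
  "subdirect_product S I B \<longleftrightarrow>
     (\<exists>T. subuniverse T (direct_product I B) \<and>
          S = (direct_product I B)\<lparr>carrier := T\<rparr> \<and>
          (\<forall>i\<in>I. (\<lambda>f. f i) ` T = carrier (B i)))"

definition nelson_sig_iso ::
  "('a, 'm) nelson_sig_scheme \<Rightarrow> ('b, 'n) nelson_sig_scheme \<Rightarrow> bool" where
  "nelson_sig_iso S T \<longleftrightarrow>
     (\<exists>h. bij_betw h (carrier S) (carrier T) \<and>
          (\<forall>x\<in>carrier S. \<forall>y\<in>carrier S.
             h (op_join S x y) = op_join T (h x) (h y) \<and>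
             h (op_meet S x y) = op_meet T (h x) (h y) \<and>
             h (op_imp S x y) = op_imp T (h x) (h y)) \<and>
          (\<forall>x\<in>carrier S. h (op_cpl S x) = op_cpl T (h x)) \<and>
          h (op_zero S) = op_zero T \<and> h (op_one S) = op_one T)"

text \<open>
  HOL cannot quantify over types inside a formula. The types of the index set and of the
  elements of the simple factors are therefore parameters; a theorem that assumes
  \<open>semisimple_nelson_algebra TYPE('i) TYPE('b) A\<close> with type variables \<open>'i\<close> and \<open>'b\<close> that
  occur nowhere else covers subdirect representations over arbitrary types.
\<close>

definition semisimple_nelson_algebra ::
  "'i itself \<Rightarrow> 'b itself \<Rightarrow> ('a, 'm) dm_alg_scheme \<Rightarrow> bool" where
  "semisimple_nelson_algebra _ _ A \<longleftrightarrow>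
     nelson_algebra A \<and>
     (\<exists>(I :: 'i set) (B :: 'i \<Rightarrow> 'b dm_alg) S.
        (\<forall>i\<in>I. nelson_algebra (B i) \<and> simple_algebra (nelson_sig_of (B i))) \<and>
        subdirect_product S I (\<lambda>i. nelson_sig_of (B i)) \<and>
        nelson_sig_iso (nelson_sig_of A) S)"


section \<open>Algebraic lattices\<close>

definition compact_element :: "('a, 'm) gorder_scheme \<Rightarrow> 'a \<Rightarrow> bool" where
  "compact_element L k \<longleftrightarrow>
     k \<in> carrier L \<and>
     (\<forall>X \<subseteq> carrier L. k \<sqsubseteq>\<^bsub>L\<^esub> \<Squnion>\<^bsub>L\<^esub> X \<longrightarrow>
        (\<exists>F \<subseteq> X. finite F \<and> k \<sqsubseteq>\<^bsub>L\<^esub> \<Squnion>\<^bsub>L\<^esub> F))"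

locale algebraic_lattice = complete_lattice L for L :: "('a, 'm) gorder_scheme" (structure) +
  assumes join_of_compacts:
    "x \<in> carrier L \<Longrightarrow> \<exists>K. (\<forall>k\<in>K. compact_element L k) \<and> x = \<Squnion> K"


section \<open>Rough sets\<close>

definition nbhd :: "'u set \<Rightarrow> 'u rel \<Rightarrow> 'u \<Rightarrow> 'u set" where
  "nbhd U R x = {y \<in> U. (x, y) \<in> R}"

definition lower_approx :: "'u set \<Rightarrow> 'u rel \<Rightarrow> 'u set \<Rightarrow> 'u set" where
  "lower_approx U R X = {x \<in> U. nbhd U R x \<subseteq> X}"

definition upper_approx :: "'u set \<Rightarrow> 'u rel \<Rightarrow> 'u set \<Rightarrow> 'u set" where
  "upper_approx U R X = {x \<in> U. nbhd U R x \<inter> X \<noteq> {}}"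

definition rough_set :: "'u set \<Rightarrow> 'u rel \<Rightarrow> 'u set \<Rightarrow> 'u set \<times> 'u set" where
  "rough_set U R X = (lower_approx U R X, upper_approx U R X)"

text \<open>
  The complement sends \<open>rough_set U R X\<close> to \<open>rough_set U R (U - X)\<close>; this does not depend
  on the choice of \<open>X\<close> (see \<open>cpl_rough_set_algebra\<close> below).
\<close>

definition rough_set_algebra :: "'u set \<Rightarrow> 'u rel \<Rightarrow> ('u set \<times> 'u set) dm_alg" where
  "rough_set_algebra U R =
     \<lparr>carrier = {rough_set U R X | X. X \<subseteq> U},
      eq = (=),
      le = (\<lambda>p q. fst p \<subseteq> fst q \<and> snd p \<subseteq> snd q),
      cpl = (\<lambda>p. THE q. \<exists>X \<subseteq> U. p = rough_set U R X \<and> q = rough_set U R (U - X))\<rparr>"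

lemma rough_set_compl:
  assumes "X \<subseteq> U"
  shows "rough_set U R (U - X) = (U - upper_approx U R X, U - lower_approx U R X)"
  using assms
  by (auto simp: rough_set_def lower_approx_def upper_approx_def nbhd_def)

lemma cpl_rough_set_algebra:
  assumes "X \<subseteq> U"
  shows "\<c>\<^bsub>rough_set_algebra U R\<^esub> (rough_set U R X) = rough_set U R (U - X)"
proof -
  have "(THE q. \<exists>Y \<subseteq> U. rough_set U R X = rough_set U R Y \<and> q = rough_set U R (U - Y))
      = rough_set U R (U - X)"
  proof (rule the_equality)
    show "\<exists>Y \<subseteq> U. rough_set U R X = rough_set U R Y \<and>
            rough_set U R (U - X) = rough_set U R (U - Y)"
      using assms by blast
  next
    fix q
    assume "\<exists>Y \<subseteq> U. rough_set U R X = rough_set U R Y \<and> q = rough_set U R (U - Y)"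
    then show "q = rough_set U R (U - X)"
      using assms by (auto simp: rough_set_compl) (auto simp: rough_set_def)
  qed
  then show ?thesis by (simp add: rough_set_algebra_def)
qed


section \<open>Isomorphism with respect to join, meet, c, 0, 1\<close>

definition dm_iso :: "('a, 'm) dm_alg_scheme \<Rightarrow> ('b, 'n) dm_alg_scheme \<Rightarrow> bool" where
  "dm_iso A B \<longleftrightarrow>
     (\<exists>h. bij_betw h (carrier A) (carrier B) \<and>
          (\<forall>x\<in>carrier A. \<forall>y\<in>carrier A.
             h (x \<squnion>\<^bsub>A\<^esub> y) = h x \<squnion>\<^bsub>B\<^esub> h y \<and>
             h (x \<sqinter>\<^bsub>A\<^esub> y) = h x \<sqinter>\<^bsub>B\<^esub> h y) \<and>
          (\<forall>x\<in>carrier A. h (\<c>\<^bsub>A\<^esub> x) = \<c>\<^bsub>B\<^esub> (h x)) \<and>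
          h \<bottom>\<^bsub>A\<^esub> = \<bottom>\<^bsub>B\<^esub> \<and> h \<top>\<^bsub>A\<^esub> = \<top>\<^bsub>B\<^esub>)"

end

theory Submission
  imports Defs
begin

text \<open>
  The simple Nelson algebras are the chains with two and three elements, so
  \<open>A\<close> is, up to isomorphism, a subalgebra of a power of the three-element chain. What is needed from
  this is one equation, \<open>a \<squnion> (a \<rightarrow> \<bottom>) = \<top>\<close>. In a simple algebra it holds because each element
  \<open>a\<close> yields a congruence, "equality where \<open>a\<close> is true" (\<open>congruence_on_congruence_modulo\<close>), which
  identifies \<open>a\<close> with \<open>\<top>\<close>. If it is the diagonal then \<open>a = \<top>\<close>; if it is the full relation then
  \<open>a \<rightarrow> \<bottom> = \<top>\<close>. Being an equation, it passes to subdirect products of simple algebras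
  (\<open>semisimple_join_imp_bottom\<close>).

  Algebraicity enters through the set \<open>J\<close> of completely join-prime elements. An algebraic
  distributive lattice satisfies the infinite distributive law (\<open>meet_sup_le\<close>), and its elements
  are meets of completely meet-irreducible ones. As the complement \<open>c\<close> turns the order upside
  down, every element is also a join of elements of \<open>J\<close> (\<open>join_primes_dense\<close>), so \<open>A\<close> is
  isomorphic to the lattice of down-sets of \<open>J\<close>.

  The complement acts on \<open>J\<close> as an order-reversing involution, the partner map, with
  \<open>partner j \<sqsubseteq> x\<close> iff not \<open>x \<sqsubseteq> c j\<close>. The Kleene law makes each \<open>j\<close> comparable to its
  partner, and the equation above leaves no other comparabilities in \<open>J\<close>
  (\<open>below_prime_eq_partner\<close>). Hence \<open>J\<close> is a disjoint union of chains \<open>{j, partner j}\<close> with one or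
  two elements. Take these chains as the classes of an equivalence on \<open>J\<close>, and send \<open>x\<close> to the
  rough set of \<open>{j \<in> J. j \<sqsubseteq> x}\<close>. The upper approximation records the chains whose least element
  lies below \<open>x\<close>, the lower approximation those whose greatest element does. A down-set of \<open>J\<close>
  amounts to such a pair of choices, so this is an order isomorphism onto the algebra of rough
  sets; the formula for the partner shows that it respects \<open>c\<close>.
\<close>

section \<open>Inequalities in distributive lattices and De Morgan algebras\<close>

context lattice
begin

lemma le_meet_iff:
  "\<lbrakk>x \<in> carrier L; y \<in> carrier L; z \<in> carrier L\<rbrakk> \<Longrightarrow> z \<sqsubseteq> x \<sqinter> y \<longleftrightarrow> z \<sqsubseteq> x \<and> z \<sqsubseteq> y"
  by (meson le_trans meet_closed meet_le meet_left meet_right)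

lemma join_le_iff:
  "\<lbrakk>x \<in> carrier L; y \<in> carrier L; z \<in> carrier L\<rbrakk> \<Longrightarrow> x \<squnion> y \<sqsubseteq> z \<longleftrightarrow> x \<sqsubseteq> z \<and> y \<sqsubseteq> z"
  by (meson le_trans join_closed join_le join_left join_right)

lemma meet_leI1:
  "\<lbrakk>x \<sqsubseteq> z; x \<in> carrier L; y \<in> carrier L; z \<in> carrier L\<rbrakk> \<Longrightarrow> x \<sqinter> y \<sqsubseteq> z"
  by (meson le_trans meet_closed meet_left)

lemma meet_leI2:
  "\<lbrakk>y \<sqsubseteq> z; x \<in> carrier L; y \<in> carrier L; z \<in> carrier L\<rbrakk> \<Longrightarrow> x \<sqinter> y \<sqsubseteq> z"
  by (meson le_trans meet_closed meet_right)

lemma le_joinI1: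
  "\<lbrakk>z \<sqsubseteq> x; x \<in> carrier L; y \<in> carrier L; z \<in> carrier L\<rbrakk> \<Longrightarrow> z \<sqsubseteq> x \<squnion> y"
  by (meson le_trans join_closed join_left)

lemma le_joinI2:
  "\<lbrakk>z \<sqsubseteq> y; x \<in> carrier L; y \<in> carrier L; z \<in> carrier L\<rbrakk> \<Longrightarrow> z \<sqsubseteq> x \<squnion> y"
  by (meson le_trans join_closed join_right)

lemmas lattice_simps = le_meet_iff join_le_iff
lemmas lattice_intros = meet_leI1 meet_leI2 le_joinI1 le_joinI2

lemma le_sandwich:
  "\<lbrakk>u \<sqsubseteq> v; p \<sqsubseteq> u; v \<sqsubseteq> q; p \<in> carrier L; q \<in> carrier L; u \<in> carrier L; v \<in> carrier L\<rbrakk>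
    \<Longrightarrow> p \<sqsubseteq> q"
  by (meson le_trans)

end

context de_morgan_algebra
begin

declare cpl_closed [simp, intro]

lemma meet_join_le_iff:
  assumes "p \<in> carrier A" "x \<in> carrier A" "y \<in> carrier A" "q \<in> carrier A"
  shows "p \<sqinter> (x \<squnion> y) \<sqsubseteq> q \<longleftrightarrow> p \<sqinter> x \<sqsubseteq> q \<and> p \<sqinter> y \<sqsubseteq> q"
  using assms by (simp add: distrib join_le_iff)

text \<open>
  This is the cut rule of sequent calculus, with meets as antecedents and joins as succedents.
  Cutting on suitable elements reduces the inequalities below to instances of weakening, which
  the simplifier finds from \<open>lattice_intros\<close>.
\<close>

lemma cut:
  assumes "p \<sqsubseteq> q \<squnion> x" "p \<sqinter> x \<sqsubseteq> q"
    and [simp]: "p \<in> carrier A" "x \<in> carrier A" "q \<in> carrier A"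
  shows "p \<sqsubseteq> q"
proof -
  have "p \<sqsubseteq> p \<sqinter> (q \<squnion> x)"
    using assms by (simp add: lattice_simps)
  moreover have "p \<sqinter> (q \<squnion> x) \<sqsubseteq> q"
    using assms(2) by (simp add: meet_join_le_iff meet_right)
  ultimately show ?thesis
    by (meson assms join_closed meet_closed le_trans)
qed

lemma cpl_le_iff: "\<lbrakk>x \<in> carrier A; y \<in> carrier A\<rbrakk> \<Longrightarrow> \<c> x \<sqsubseteq> \<c> y \<longleftrightarrow> y \<sqsubseteq> x"
  by (metis cpl_antitone)

lemma le_cpl_iff: "\<lbrakk>x \<in> carrier A; y \<in> carrier A\<rbrakk> \<Longrightarrow> x \<sqsubseteq> \<c> y \<longleftrightarrow> y \<sqsubseteq> \<c> x"
  by (metis cpl_antitone cpl_closed cpl_cpl)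

lemma cpl_le_swap: "\<lbrakk>x \<in> carrier A; y \<in> carrier A\<rbrakk> \<Longrightarrow> \<c> x \<sqsubseteq> y \<longleftrightarrow> \<c> y \<sqsubseteq> x"
  by (metis cpl_antitone cpl_closed cpl_cpl)

lemma cpl_join:
  assumes [simp]: "x \<in> carrier A" "y \<in> carrier A"
  shows "\<c> (x \<squnion> y) = \<c> x \<sqinter> \<c> y"
proof (rule le_antisym)
  show "\<c> (x \<squnion> y) \<sqsubseteq> \<c> x \<sqinter> \<c> y"
    by (simp add: lattice_simps cpl_le_iff join_left join_right)
  have "x \<sqsubseteq> \<c> (\<c> x \<sqinter> \<c> y)" "y \<sqsubseteq> \<c> (\<c> x \<sqinter> \<c> y)"
    by (subst le_cpl_iff; simp add: meet_left meet_right)+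
  then have "x \<squnion> y \<sqsubseteq> \<c> (\<c> x \<sqinter> \<c> y)"
    by (simp add: join_le_iff)
  then show "\<c> x \<sqinter> \<c> y \<sqsubseteq> \<c> (x \<squnion> y)"
    by (metis assms cpl_closed join_closed le_cpl_iff meet_closed)
qed simp_all

lemma cpl_meet:
  assumes [simp]: "x \<in> carrier A" "y \<in> carrier A"
  shows "\<c> (x \<sqinter> y) = \<c> x \<squnion> \<c> y"
  using cpl_join[of "\<c> x" "\<c> y"] by (metis assms cpl_closed cpl_cpl join_closed)

end


section \<open>Simple Nelson algebras\<close>

context quasi_nelson_algebra
begin

lemma is_rel_pseudocomplement_imp:
  assumes "a \<in> carrier A" "b \<in> carrier A"
  shows "is_rel_pseudocomplement A a (\<c> a \<squnion> b) (nelson_imp A a b)"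
  unfolding nelson_imp_def
proof (rule theI')
  show "\<exists>!r. is_rel_pseudocomplement A a (\<c> a \<squnion> b) r"
    using rel_pseudocomplement_exists[OF assms]
    by (auto simp: is_rel_pseudocomplement_def intro: greatest_unique)
qed

lemma imp_closed [simp, intro]:
  "\<lbrakk>a \<in> carrier A; b \<in> carrier A\<rbrakk> \<Longrightarrow> nelson_imp A a b \<in> carrier A"
  using is_rel_pseudocomplement_imp by (auto simp: is_rel_pseudocomplement_def greatest_def)

lemma le_imp_iff:
  assumes [simp]: "a \<in> carrier A" "b \<in> carrier A" "z \<in> carrier A"
  shows "z \<sqsubseteq> nelson_imp A a b \<longleftrightarrow> a \<sqinter> z \<sqsubseteq> \<c> a \<squnion> b"
proof
  have *: "greatest A (nelson_imp A a b) {x \<in> carrier A. a \<sqinter> x \<sqsubseteq> \<c> a \<squnion> b}"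
    using is_rel_pseudocomplement_imp[of a b] by (simp add: is_rel_pseudocomplement_def)
  show "a \<sqinter> z \<sqsubseteq> \<c> a \<squnion> b \<Longrightarrow> z \<sqsubseteq> nelson_imp A a b"
    using greatest_le[OF *] by simp
  assume z: "z \<sqsubseteq> nelson_imp A a b"
  have "a \<sqinter> nelson_imp A a b \<sqsubseteq> \<c> a \<squnion> b"
    using greatest_mem[OF *] by simp
  then show "a \<sqinter> z \<sqsubseteq> \<c> a \<squnion> b"
    by (rule le_sandwich) (use z in \<open>simp_all add: lattice_simps lattice_intros\<close>)
qed

end

text \<open>
  On the three-element chain this relation says: if \<open>a = \<top>\<close> then \<open>x \<sqsubseteq> y\<close>. So over a subalgebra of
  a power of that chain it compares \<open>x\<close> and \<open>y\<close> at the coordinates where \<open>a\<close> is \<open>\<top>\<close>.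
\<close>

definition le_modulo :: "('a, 'm) dm_alg_scheme \<Rightarrow> 'a \<Rightarrow> 'a \<Rightarrow> 'a \<Rightarrow> bool" where
  "le_modulo A a x y \<longleftrightarrow> a \<sqinter>\<^bsub>A\<^esub> x \<sqsubseteq>\<^bsub>A\<^esub> \<c>\<^bsub>A\<^esub> a \<squnion>\<^bsub>A\<^esub> y"

definition congruence_modulo :: "('a, 'm) dm_alg_scheme \<Rightarrow> 'a \<Rightarrow> 'a rel" where
  "congruence_modulo A a =
     {(x, y). x \<in> carrier A \<and> y \<in> carrier A \<and> le_modulo A a x y \<and> le_modulo A a y x}"

context de_morgan_algebra
begin

lemma le_modulo_refl:
  "\<lbrakk>a \<in> carrier A; x \<in> carrier A\<rbrakk> \<Longrightarrow> le_modulo A a x x"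
  unfolding le_modulo_def by (simp add: lattice_intros)

lemma le_modulo_trans:
  assumes "le_modulo A a x y" "le_modulo A a y z"
    and [simp]: "a \<in> carrier A" "x \<in> carrier A" "y \<in> carrier A" "z \<in> carrier A"
  shows "le_modulo A a x z"
  unfolding le_modulo_def
proof (rule cut[where x = y])
  show "a \<sqinter> x \<sqsubseteq> \<c> a \<squnion> z \<squnion> y"
    by (rule le_sandwich[OF assms(1)[unfolded le_modulo_def]])
      (simp_all add: lattice_simps lattice_intros)
  show "a \<sqinter> x \<sqinter> y \<sqsubseteq> \<c> a \<squnion> z"
    by (rule le_sandwich[OF assms(2)[unfolded le_modulo_def]])
      (simp_all add: lattice_simps lattice_intros)
qed simp_all

lemma le_modulo_cpl:
  assumes "le_modulo A a x y"
    and [simp]: "a \<in> carrier A" "x \<in> carrier A" "y \<in> carrier A"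
  shows "le_modulo A a (\<c> y) (\<c> x)"
proof -
  have "\<c> (\<c> a \<squnion> y) \<sqsubseteq> \<c> (a \<sqinter> x)"
    using assms by (simp add: le_modulo_def cpl_le_iff)
  then show ?thesis
    by (simp add: le_modulo_def cpl_join cpl_meet cpl_cpl)
qed

lemma le_modulo_join:
  assumes "le_modulo A a x x'" "le_modulo A a y y'"
    and [simp]: "a \<in> carrier A" "x \<in> carrier A" "y \<in> carrier A" "x' \<in> carrier A" "y' \<in> carrier A"
  shows "le_modulo A a (x \<squnion> y) (x' \<squnion> y')"
proof -
  have "a \<sqinter> x \<sqsubseteq> \<c> a \<squnion> (x' \<squnion> y')"
    by (rule le_sandwich[OF assms(1)[unfolded le_modulo_def]])
      (simp_all add: lattice_simps lattice_intros)
  moreover have "a \<sqinter> y \<sqsubseteq> \<c> a \<squnion> (x' \<squnion> y')"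
    by (rule le_sandwich[OF assms(2)[unfolded le_modulo_def]])
      (simp_all add: lattice_simps lattice_intros)
  ultimately show ?thesis
    by (simp add: le_modulo_def meet_join_le_iff)
qed

lemma le_modulo_meet:
  assumes "le_modulo A a x x'" "le_modulo A a y y'"
    and [simp]: "a \<in> carrier A" "x \<in> carrier A" "y \<in> carrier A" "x' \<in> carrier A" "y' \<in> carrier A"
  shows "le_modulo A a (x \<sqinter> y) (x' \<sqinter> y')"
proof -
  have "le_modulo A a (\<c> (\<c> x \<squnion> \<c> y)) (\<c> (\<c> x' \<squnion> \<c> y'))"
    using assms by (intro le_modulo_cpl le_modulo_join) simp_all
  then show ?thesis
    by (simp add: cpl_join cpl_cpl)
qed

end

context nelson_algebra
begin

text \<open>
  The Nelson law is what makes implication compatible: since \<open>x' \<rightarrow> y'\<close> is itself defined by a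
  maximality condition, the claim about \<open>a\<close> has to be moved inside, and the law rewrites
  \<open>a \<rightarrow> (x' \<rightarrow> y')\<close> as \<open>(a \<sqinter> x') \<rightarrow> y'\<close>. What remains is an inequality without implications.
\<close>

lemma le_modulo_imp:
  assumes "le_modulo A a x' x" "le_modulo A a y y'"
    and [simp]: "a \<in> carrier A" "x \<in> carrier A" "y \<in> carrier A" "x' \<in> carrier A" "y' \<in> carrier A"
  shows "le_modulo A a (nelson_imp A x y) (nelson_imp A x' y')"
proof -
  define w where "w = nelson_imp A x y"
  have [simp]: "w \<in> carrier A" by (simp add: w_def)
  \<comment> \<open>Modus ponens, weakened by the term \<open>\<c> x\<close> that the definition of implication carries.\<close>
  have mp: "x \<sqinter> w \<sqsubseteq> \<c> x \<squnion> y"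
    using le_imp_iff[of x y w] by (simp add: w_def)
  let ?p = "a \<sqinter> x' \<sqinter> w" and ?q = "\<c> (a \<sqinter> x') \<squnion> y'"
  have "?p \<sqsubseteq> ?q"
  proof (rule cut[where x = x])
    show "?p \<sqsubseteq> ?q \<squnion> x"
      by (rule le_sandwich[OF assms(1)[unfolded le_modulo_def]])
        (simp_all add: lattice_simps cpl_meet lattice_intros)
    show "?p \<sqinter> x \<sqsubseteq> ?q"
    proof (rule cut[where x = y])
      show "?p \<sqinter> x \<sqsubseteq> ?q \<squnion> y"
      proof (rule cut[where x = "\<c> x"])
        show "?p \<sqinter> x \<sqsubseteq> ?q \<squnion> y \<squnion> \<c> x"
          by (rule le_sandwich[OF mp]) (simp_all add: lattice_simps lattice_intros)
        show "?p \<sqinter> x \<sqinter> \<c> x \<sqsubseteq> ?q \<squnion> y"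
          by (rule le_sandwich[OF le_modulo_cpl[OF assms(1), unfolded le_modulo_def]])
            (simp_all add: lattice_simps cpl_meet lattice_intros)
      qed simp_all
      show "?p \<sqinter> x \<sqinter> y \<sqsubseteq> ?q"
        by (rule le_sandwich[OF assms(2)[unfolded le_modulo_def]])
          (simp_all add: lattice_simps cpl_meet lattice_intros)
    qed simp_all
  qed simp_all
  then have "w \<sqsubseteq> nelson_imp A (a \<sqinter> x') y'"
    by (simp add: le_imp_iff)
  also have "\<dots> = nelson_imp A a (nelson_imp A x' y')"
    by (simp add: nelson)
  finally show ?thesis
    by (simp add: le_modulo_def le_imp_iff w_def)
qed

lemma congruence_on_congruence_modulo:
  assumes [simp]: "a \<in> carrier A"
  shows "congruence_on (nelson_sig_of A) (congruence_modulo A a)"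
  unfolding congruence_on_def nelson_sig_of_def congruence_modulo_def
  by (auto simp: equiv_def refl_on_def sym_def trans_def le_modulo_refl
      intro: le_modulo_trans le_modulo_cpl le_modulo_join le_modulo_meet le_modulo_imp)

text \<open>
  The congruence of \<open>a\<close> always relates \<open>a\<close> to \<open>\<top>\<close>, and it relates \<open>\<top>\<close> to \<open>\<bottom>\<close> only if
  \<open>a \<sqsubseteq> \<c> a\<close>. So in a simple algebra every \<open>a \<noteq> \<top>\<close> satisfies \<open>a \<sqsubseteq> \<c> a\<close>, as in the
  three-element chain.
\<close>

lemma simple_join_imp_bottom:
  assumes simple: "simple_algebra (nelson_sig_of A)" and [simp]: "a \<in> carrier A"
  shows "a \<squnion> nelson_imp A a \<bottom> = \<top>"
proof -
  have "congruence_modulo A a \<in> {Id_on (carrier A), carrier A \<times> carrier A}"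
    using simple congruence_on_congruence_modulo[of a]
    unfolding simple_algebra_def by (auto simp: nelson_sig_of_def)
  then consider "congruence_modulo A a = Id_on (carrier A)"
    | "congruence_modulo A a = carrier A \<times> carrier A" by blast
  then have "\<top> \<sqsubseteq> a \<squnion> nelson_imp A a \<bottom>"
  proof cases
    case 1
    have "(a, \<top>) \<in> congruence_modulo A a"
      by (simp add: congruence_modulo_def le_modulo_def lattice_intros)
    with 1 have "a = \<top>" by auto
    then show ?thesis by (simp add: join_left)
  next
    case 2
    then have "(\<top>, \<bottom>) \<in> congruence_modulo A a" by simp
    then have "\<top> \<sqsubseteq> nelson_imp A a \<bottom>"
      by (simp add: congruence_modulo_def le_modulo_def le_imp_iff)
    then show ?thesis by (simp add: lattice_intros)
  qed
  then show ?thesis by (simp add: le_antisym)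
qed

end

text \<open>
  Both sides are terms in the signature with respect to which the subdirect representation is an
  embedding, so they may be compared in each factor.
\<close>

lemma semisimple_join_imp_bottom:
  fixes A :: "('a, 'm) dm_alg_scheme" (structure)
  assumes ss: "semisimple_nelson_algebra TYPE('i) TYPE('b) A" and a: "a \<in> carrier A"
  shows "a \<squnion> nelson_imp A a \<bottom> = \<top>"
proof -
  from ss interpret nelson_algebra A by (simp add: semisimple_nelson_algebra_def)
  from ss obtain I :: "'i set" and B :: "'i \<Rightarrow> 'b dm_alg" and T h where
    B: "\<And>i. i \<in> I \<Longrightarrow> nelson_algebra (B i) \<and> simple_algebra (nelson_sig_of (B i))"
    and T: "subuniverse T (direct_product I (\<lambda>i. nelson_sig_of (B i)))"
    and bij: "bij_betw h (carrier A) T"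
    and hjoin: "\<And>x y. \<lbrakk>x \<in> carrier A; y \<in> carrier A\<rbrakk> \<Longrightarrow> h (x \<squnion> y) = (\<lambda>i\<in>I. h x i \<squnion>\<^bsub>B i\<^esub> h y i)"
    and himp: "\<And>x y. \<lbrakk>x \<in> carrier A; y \<in> carrier A\<rbrakk>
      \<Longrightarrow> h (nelson_imp A x y) = (\<lambda>i\<in>I. nelson_imp (B i) (h x i) (h y i))"
    and hbot: "h \<bottom> = (\<lambda>i\<in>I. \<bottom>\<^bsub>B i\<^esub>)" and htop: "h \<top> = (\<lambda>i\<in>I. \<top>\<^bsub>B i\<^esub>)"
  proof -
    from ss obtain I :: "'i set" and B :: "'i \<Rightarrow> 'b dm_alg" and S where
      B: "\<And>i. i \<in> I \<Longrightarrow> nelson_algebra (B i) \<and> simple_algebra (nelson_sig_of (B i))"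
      and "subdirect_product S I (\<lambda>i. nelson_sig_of (B i))"
      and iso: "nelson_sig_iso (nelson_sig_of A) S"
      by (auto simp: semisimple_nelson_algebra_def)
    then obtain T where T: "subuniverse T (direct_product I (\<lambda>i. nelson_sig_of (B i)))"
      and S: "S = (direct_product I (\<lambda>i. nelson_sig_of (B i)))\<lparr>carrier := T\<rparr>"
      unfolding subdirect_product_def by blast
    from iso obtain h where h: "bij_betw h (carrier (nelson_sig_of A)) (carrier S)"
      "\<And>x y. \<lbrakk>x \<in> carrier (nelson_sig_of A); y \<in> carrier (nelson_sig_of A)\<rbrakk>
        \<Longrightarrow> h (op_join (nelson_sig_of A) x y) = op_join S (h x) (h y) \<and>
          h (op_imp (nelson_sig_of A) x y) = op_imp S (h x) (h y)"
      "h (op_zero (nelson_sig_of A)) = op_zero S" "h (op_one (nelson_sig_of A)) = op_one S"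
      unfolding nelson_sig_iso_def by blast
    show thesis
      by (rule that[OF B T, of h])
        (use h in \<open>simp_all add: S direct_product_def nelson_sig_of_def\<close>)
  qed
  have ha: "h a i \<in> carrier (B i)" if "i \<in> I" for i
  proof -
    have "h a \<in> T" using bij a by (auto simp: bij_betw_def)
    with T that show ?thesis
      by (auto simp: subuniverse_def direct_product_def nelson_sig_of_def)
  qed
  have "h (a \<squnion> nelson_imp A a \<bottom>) = (\<lambda>i\<in>I. h a i \<squnion>\<^bsub>B i\<^esub> nelson_imp (B i) (h a i) \<bottom>\<^bsub>B i\<^esub>)"
    using a by (auto simp: hjoin himp hbot intro!: restrict_ext)
  also have "\<dots> = (\<lambda>i\<in>I. \<top>\<^bsub>B i\<^esub>)"
    using B ha by (auto intro!: restrict_ext nelson_algebra.simple_join_imp_bottom)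
  also have "\<dots> = h \<top>" by (simp add: htop)
  finally show ?thesis
    using bij a by (auto simp: bij_betw_def dest: inj_onD)
qed

section \<open>Completely join-prime elements\<close>

text \<open>
  Taking \<open>X = {}\<close> excludes the least element.
\<close>

definition join_primes :: "('a, 'm) gorder_scheme \<Rightarrow> 'a set" where
  "join_primes L =
     {j \<in> carrier L. \<forall>X \<subseteq> carrier L. j \<sqsubseteq>\<^bsub>L\<^esub> \<Squnion>\<^bsub>L\<^esub> X \<longrightarrow> (\<exists>x\<in>X. j \<sqsubseteq>\<^bsub>L\<^esub> x)}"

lemma join_primes_closed [simp, intro]: "j \<in> join_primes L \<Longrightarrow> j \<in> carrier L"
  by (simp add: join_primes_def)

lemma join_primeD:
  fixes L (structure)
  shows "\<lbrakk>j \<in> join_primes L; X \<subseteq> carrier L; j \<sqsubseteq> \<Squnion> X\<rbrakk> \<Longrightarrow> \<exists>x\<in>X. j \<sqsubseteq> x"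
  unfolding join_primes_def by blast

locale algebraic_de_morgan_algebra =
  de_morgan_algebra A + algebraic_lattice A for A :: "('a, 'm) dm_alg_scheme" (structure)
begin

text \<open>
  This and the next lemma are the frame law, finite and infinite. Compactness reduces the infinite
  case to the finite one.
\<close>

lemma meet_finite_sup_le:
  assumes "finite F" "F \<subseteq> carrier A" "x \<in> carrier A" "q \<in> carrier A"
    and "\<And>y. y \<in> F \<Longrightarrow> x \<sqinter> y \<sqsubseteq> q"
  shows "x \<sqinter> \<Squnion> F \<sqsubseteq> q"
  using assms(1,2,5)
proof induction
  case empty
  have "\<Squnion> {} \<sqsubseteq> q" by (rule sup_least) (simp_all add: assms(4))
  then show ?case using assms(3,4) by (simp add: meet_leI2)
next
  case (insert y F)
  then have F: "y \<in> carrier A" "F \<subseteq> carrier A" by auto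
  have "x \<sqinter> \<Squnion> F \<sqsubseteq> q" using insert.IH[OF F(2)] insert.prems(2) by simp
  moreover have "\<Squnion> (insert y F) = y \<squnion> \<Squnion> F"
    using weak_sup_insert[OF F] unfolding eq_is_equal .
  ultimately show ?case
    using insert.prems(2)[of y] F assms(3,4) by (simp add: meet_join_le_iff)
qed

lemma meet_sup_le:
  assumes X: "X \<subseteq> carrier A" and [simp]: "x \<in> carrier A" "q \<in> carrier A"
    and le: "\<And>y. y \<in> X \<Longrightarrow> x \<sqinter> y \<sqsubseteq> q"
  shows "x \<sqinter> \<Squnion> X \<sqsubseteq> q"
proof -
  have [simp]: "\<Squnion> X \<in> carrier A" using X by simp
  obtain K where K: "\<And>k. k \<in> K \<Longrightarrow> compact_element A k" "x \<sqinter> \<Squnion> X = \<Squnion> K"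
    using join_of_compacts[of "x \<sqinter> \<Squnion> X"] by auto
  have KA: "K \<subseteq> carrier A" using K(1) by (auto simp: compact_element_def)
  have "\<Squnion> K \<sqsubseteq> q"
  proof (rule sup_least[OF KA])
    fix k assume k: "k \<in> K"
    then have [simp]: "k \<in> carrier A" using KA by auto
    have "k \<sqsubseteq> x \<sqinter> \<Squnion> X" using sup_upper[OF KA k] K(2) by simp
    then have kx: "k \<sqsubseteq> x" and kX: "k \<sqsubseteq> \<Squnion> X" by (simp_all add: le_meet_iff)
    then obtain F where F: "F \<subseteq> X" "finite F" "k \<sqsubseteq> \<Squnion> F"
      using K(1)[OF k] X unfolding compact_element_def by blast
    then have FA: "F \<subseteq> carrier A" using X by auto
    then have "x \<sqinter> \<Squnion> F \<sqsubseteq> q" using F le by (intro meet_finite_sup_le) auto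
    moreover have "k \<sqsubseteq> x \<sqinter> \<Squnion> F" using kx F(3) FA by (simp add: le_meet_iff)
    ultimately show "k \<sqsubseteq> q" using le_trans[of k "x \<sqinter> \<Squnion> F" q] FA by simp
  qed simp
  then show ?thesis using K(2) by simp
qed

text \<open>
  A compact element below the join of a chain lies below a finite subjoin, and a finite part of a
  chain has an upper bound in the chain. This is the chain condition for Zorn's lemma below.
\<close>

lemma compact_le_chain_sup:
  assumes k: "compact_element A k" and C: "C \<subseteq> carrier A" "C \<noteq> {}"
    and chain: "\<And>x y. \<lbrakk>x \<in> C; y \<in> C\<rbrakk> \<Longrightarrow> x \<sqsubseteq> y \<or> y \<sqsubseteq> x"
    and le: "k \<sqsubseteq> \<Squnion> C"
  shows "\<exists>x\<in>C. k \<sqsubseteq> x"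
proof -
  have [simp]: "k \<in> carrier A" using k by (simp add: compact_element_def)
  obtain F where F: "F \<subseteq> C" "finite F" "k \<sqsubseteq> \<Squnion> F"
    using k le C unfolding compact_element_def by blast
  have "\<exists>m\<in>C. \<forall>x\<in>F. x \<sqsubseteq> m"
    using F(2,1)
  proof induction
    case empty
    then show ?case using C by auto
  next
    case (insert x F)
    then obtain m where m: "m \<in> C" "\<forall>y\<in>F. y \<sqsubseteq> m" by auto
    show ?case
    proof (cases "x \<sqsubseteq> m")
      case True
      with m show ?thesis by auto
    next
      case False
      then have "m \<sqsubseteq> x" using chain[of x m] m(1) insert.prems by simp
      have "y \<sqsubseteq> x" if "y \<in> F" for y
        using that m insert.prems C \<open>m \<sqsubseteq> x\<close> le_trans[of y m x] by blast
      then have "\<forall>y\<in>insert x F. y \<sqsubseteq> x" using insert.prems C by auto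
      then show ?thesis using insert.prems by auto
    qed
  qed
  then obtain m where m: "m \<in> C" "\<forall>x\<in>F. x \<sqsubseteq> m" by auto
  then have "\<Squnion> F \<sqsubseteq> m" using F C by (intro sup_least) auto
  moreover have "F \<subseteq> carrier A" "m \<in> carrier A" using F m C by auto
  ultimately have "k \<sqsubseteq> m" using F(3) le_trans[of k "\<Squnion> F" m] by simp
  with m show ?thesis by auto
qed

text \<open>
  After complementation, \<open>\<c> y\<close> is not below \<open>\<c> x\<close>, and this is witnessed by a compact \<open>k\<close>. An
  element \<open>m\<close> that is maximal among those above \<open>\<c> x\<close> and not above \<open>k\<close> is completely
  meet-irreducible, and \<open>\<c> m\<close> is the required element. Its primeness uses the frame law
  on the side of \<open>\<c> m\<close>: if no \<open>z \<in> X\<close> is above \<open>\<c> m\<close> then, by maximality, all joins \<open>m \<squnion> \<c> z\<close>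
  are above \<open>k\<close>, that is, all meets \<open>\<c> m \<sqinter> z\<close> are below \<open>\<c> k\<close>, hence so is \<open>\<c> m \<sqinter> \<Squnion> X\<close>.
\<close>

lemma join_primes_dense:
  assumes [simp]: "x \<in> carrier A" "y \<in> carrier A" and nle: "\<not> x \<sqsubseteq> y"
  shows "\<exists>j\<in>join_primes A. j \<sqsubseteq> x \<and> \<not> j \<sqsubseteq> y"
proof -
  obtain K where K: "\<And>k. k \<in> K \<Longrightarrow> compact_element A k" "\<c> y = \<Squnion> K"
    using join_of_compacts[of "\<c> y"] by auto
  have KA: "K \<subseteq> carrier A" using K(1) by (auto simp: compact_element_def)
  have "\<not> \<Squnion> K \<sqsubseteq> \<c> x" using nle K(2) by (metis cpl_le_iff assms(1,2))
  then obtain k where kK: "k \<in> K" and kx: "\<not> k \<sqsubseteq> \<c> x"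
    using sup_least[OF KA, of "\<c> x"] by (metis assms(1) cpl_closed)
  have k [simp]: "k \<in> carrier A" using kK KA by auto
  have kc: "compact_element A k" using K kK by simp
  have ky: "k \<sqsubseteq> \<c> y" using sup_upper[OF KA kK] K(2) by simp
  let ?S = "{m \<in> carrier A. \<c> x \<sqsubseteq> m \<and> \<not> k \<sqsubseteq> m}"
  have "\<exists>m\<in>?S. \<forall>z\<in>?S. m \<sqsubseteq> z \<longrightarrow> z = m"
  proof (rule predicate_Zorn)
    show "partial_order_on ?S (relation_of (\<sqsubseteq>) ?S)"
      by (rule partial_order_on_relation_ofI) (auto intro: le_trans)
    fix C assume "C \<in> Chains (relation_of (\<sqsubseteq>) ?S)"
    then have CS: "C \<subseteq> ?S" and chain: "\<And>x y. \<lbrakk>x \<in> C; y \<in> C\<rbrakk> \<Longrightarrow> x \<sqsubseteq> y \<or> y \<sqsubseteq> x"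
      by (auto simp: Chains_def relation_of_def)
    show "\<exists>u\<in>?S. \<forall>a\<in>C. a \<sqsubseteq> u"
    proof (cases "C = {}")
      case True
      then show ?thesis using kx by (intro bexI[of _ "\<c> x"]) simp_all
    next
      case False
      then obtain c where c: "c \<in> C" by auto
      have CA: "C \<subseteq> carrier A" using CS by auto
      have "\<c> x \<sqsubseteq> c" using CS c by auto
      then have "\<c> x \<sqsubseteq> \<Squnion> C"
        using sup_upper[OF CA c] c CA le_trans[of "\<c> x" c "\<Squnion> C"] by auto
      moreover have "\<not> k \<sqsubseteq> \<Squnion> C"
        using compact_le_chain_sup[OF kc CA False chain] CS by blast
      ultimately show ?thesis using sup_upper[OF CA] CA by (intro bexI[of _ "\<Squnion> C"]) simp_all
    qed
  qed
  then obtain m where m [simp]: "m \<in> carrier A" and xm: "\<c> x \<sqsubseteq> m" and km: "\<not> k \<sqsubseteq> m"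
    and max: "\<And>z. \<lbrakk>z \<in> carrier A; \<c> x \<sqsubseteq> z; \<not> k \<sqsubseteq> z; m \<sqsubseteq> z\<rbrakk> \<Longrightarrow> z = m"
    by auto
  have "\<c> m \<in> join_primes A"
    unfolding join_primes_def
  proof (clarsimp, rule ccontr)
    fix X assume X: "X \<subseteq> carrier A" and le: "\<c> m \<sqsubseteq> \<Squnion> X" and no: "\<not> (\<exists>z\<in>X. \<c> m \<sqsubseteq> z)"
    have "\<c> m \<sqinter> \<Squnion> X \<sqsubseteq> \<c> k"
    proof (rule meet_sup_le[OF X])
      fix z assume z: "z \<in> X"
      then have [simp]: "z \<in> carrier A" using X by auto
      have "\<not> \<c> z \<sqsubseteq> m" using no z by (metis cpl_le_swap \<open>z \<in> carrier A\<close> m)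
      then have "m \<squnion> \<c> z \<noteq> m" using join_right[of m "\<c> z"] by force
      moreover have "\<c> x \<sqsubseteq> m \<squnion> \<c> z" "m \<sqsubseteq> m \<squnion> \<c> z"
        using xm by (simp_all add: le_joinI1)
      ultimately have "k \<sqsubseteq> m \<squnion> \<c> z"
        using max[of "m \<squnion> \<c> z"] by (metis cpl_closed join_closed m \<open>z \<in> carrier A\<close>)
      then have "\<c> (m \<squnion> \<c> z) \<sqsubseteq> \<c> k" by (simp add: cpl_le_iff)
      then show "\<c> m \<sqinter> z \<sqsubseteq> \<c> k" by (simp add: cpl_join cpl_cpl)
    qed simp_all
    then have "\<c> m \<sqsubseteq> \<c> k"
      using le X le_trans[of "\<c> m" "\<c> m \<sqinter> \<Squnion> X" "\<c> k"] by (simp add: le_meet_iff)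
    then show False using km by (simp add: cpl_le_iff)
  qed
  moreover have "\<c> m \<sqsubseteq> x" using xm by (simp add: cpl_le_swap)
  moreover have "\<not> \<c> m \<sqsubseteq> y"
  proof
    assume "\<c> m \<sqsubseteq> y"
    then have "\<c> y \<sqsubseteq> m" by (simp add: cpl_le_swap)
    with ky km show False using le_trans[of k "\<c> y" m] by simp
  qed
  ultimately show ?thesis by auto
qed

text \<open>
  If \<open>j\<close> is completely join-prime then \<open>\<c> j\<close> is completely meet-prime, and the elements that are not
  below a completely meet-prime element have a least one among them. In the down-set
  representation of a De Morgan algebra this is the involution on points that induces the
  complement.
\<close>

definition partner :: "'a \<Rightarrow> 'a" where
  "partner j = \<Sqinter> {x \<in> carrier A. \<not> x \<sqsubseteq> \<c> j}"

lemma partner_closed [simp, intro]: "partner j \<in> carrier A"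
  unfolding partner_def by (rule inf_closed) auto

text \<open>
  The content is that \<open>partner j\<close> itself is not below \<open>\<c> j\<close>. Otherwise \<open>j\<close> would be below the
  join of the complements of all \<open>x\<close> with \<open>\<not> x \<sqsubseteq> \<c> j\<close>, hence below one of them.
\<close>

lemma partner_le_iff:
  assumes j: "j \<in> join_primes A" and x [simp]: "x \<in> carrier A"
  shows "partner j \<sqsubseteq> x \<longleftrightarrow> \<not> x \<sqsubseteq> \<c> j"
proof
  let ?X = "{x \<in> carrier A. \<not> x \<sqsubseteq> \<c> j}"
  have jA [simp]: "j \<in> carrier A" using j by simp
  show "\<not> x \<sqsubseteq> \<c> j \<Longrightarrow> partner j \<sqsubseteq> x"
    unfolding partner_def by (rule inf_lower) auto
  assume le: "partner j \<sqsubseteq> x"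
  show "\<not> x \<sqsubseteq> \<c> j"
  proof
    assume "x \<sqsubseteq> \<c> j"
    with le have "partner j \<sqsubseteq> \<c> j" by (meson cpl_closed jA le_trans partner_closed x)
    moreover have cX: "cpl A ` ?X \<subseteq> carrier A" by auto
    then have sA [simp]: "\<Squnion> (cpl A ` ?X) \<in> carrier A" by simp
    have "\<c> (\<Squnion> (cpl A ` ?X)) \<sqsubseteq> partner j"
      unfolding partner_def
    proof (rule inf_greatest)
      fix z assume "z \<in> ?X"
      then show "\<c> (\<Squnion> (cpl A ` ?X)) \<sqsubseteq> z"
        using sup_upper[OF cX, of "\<c> z"] by (subst cpl_le_swap) auto
    qed auto
    ultimately have "\<c> (\<Squnion> (cpl A ` ?X)) \<sqsubseteq> \<c> j"
      using le_trans[of _ "partner j" "\<c> j"] by simp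
    then have "j \<sqsubseteq> \<Squnion> (cpl A ` ?X)" by (simp add: cpl_le_iff)
    from join_primeD[OF j cX this] obtain z
      where z: "z \<in> carrier A" "\<not> z \<sqsubseteq> \<c> j" "j \<sqsubseteq> \<c> z"
      by auto
    then show False using le_cpl_iff[OF jA z(1)] by simp
  qed
qed

lemma partner_prime [simp, intro]:
  assumes j: "j \<in> join_primes A"
  shows "partner j \<in> join_primes A"
  unfolding join_primes_def
proof (clarsimp, rule ccontr)
  fix X assume X: "X \<subseteq> carrier A" and le: "partner j \<sqsubseteq> \<Squnion> X"
    and none: "\<not> (\<exists>x\<in>X. partner j \<sqsubseteq> x)"
  have "\<Squnion> X \<sqsubseteq> \<c> j"
  proof (rule sup_least[OF X])
    show "\<c> j \<in> carrier A" using j by simp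
    show "x \<sqsubseteq> \<c> j" if "x \<in> X" for x
      using that none X by (metis j partner_le_iff subsetD)
  qed
  then show False using le partner_le_iff[OF j sup_closed[OF X]] by simp
qed

lemma partner_partner [simp]:
  assumes j: "j \<in> join_primes A"
  shows "partner (partner j) = j"
proof -
  have "partner (partner j) \<sqsubseteq> x \<longleftrightarrow> j \<sqsubseteq> x" if "x \<in> carrier A" for x
  proof -
    have "partner (partner j) \<sqsubseteq> x \<longleftrightarrow> \<not> partner j \<sqsubseteq> \<c> x"
      using that j by (simp add: partner_le_iff[of "partner j"] le_cpl_iff)
    also have "\<dots> \<longleftrightarrow> j \<sqsubseteq> x"
      using that j by (simp add: partner_le_iff cpl_le_iff)
    finally show ?thesis .
  qed
  then show ?thesis using j by (meson join_primes_closed le_antisym le_refl partner_closed)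
qed

lemma partner_antitone:
  assumes "j \<in> join_primes A" "k \<in> join_primes A" "k \<sqsubseteq> j"
  shows "partner j \<sqsubseteq> partner k"
proof -
  have "\<not> partner k \<sqsubseteq> \<c> k"
    using assms partner_le_iff[of k "partner k"] by simp
  moreover have "\<c> j \<sqsubseteq> \<c> k" using assms by (simp add: cpl_le_iff)
  ultimately have "\<not> partner k \<sqsubseteq> \<c> j"
    using assms by (meson cpl_closed join_primes_closed le_trans partner_closed)
  then show ?thesis using assms by (simp add: partner_le_iff)
qed

lemma prime_le_cpl_iff:
  assumes "j \<in> join_primes A" "x \<in> carrier A"
  shows "j \<sqsubseteq> \<c> x \<longleftrightarrow> \<not> partner j \<sqsubseteq> x"
  using assms by (simp add: partner_le_iff le_cpl_iff)

end

text \<open>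
  The last assumption expresses the equation \<open>a \<squnion> (a \<rightarrow> \<bottom>) = \<top>\<close> without implication, as the
  witness \<open>r\<close> can be any element below \<open>a \<rightarrow> \<bottom>\<close>.
\<close>

locale algebraic_three_valued_algebra =
  kleene_algebra A + algebraic_lattice A for A :: "('a, 'm) dm_alg_scheme" (structure) +
  assumes weak_complement_exists:
    "a \<in> carrier A \<Longrightarrow> \<exists>r\<in>carrier A. a \<squnion> r = \<top> \<and> a \<sqinter> r \<sqsubseteq> \<c> a"
begin

sublocale algebraic_de_morgan_algebra A ..

text \<open>
  If \<open>j\<close> and \<open>partner j\<close> are incomparable, each is below its own complement, and the Kleene law
  then puts \<open>j\<close> below \<open>\<c> (partner j)\<close>, which is impossible since \<open>j\<close> is the partner of
  \<open>partner j\<close>.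
\<close>

lemma partner_comparable:
  assumes j: "j \<in> join_primes A"
  shows "j \<sqsubseteq> partner j \<or> partner j \<sqsubseteq> j"
proof (rule ccontr)
  assume "\<not> ?thesis"
  then have "j \<sqsubseteq> \<c> j" and p: "partner j \<sqsubseteq> \<c> (partner j)"
    using j by (simp_all add: prime_le_cpl_iff)
  then have "j \<sqsubseteq> j \<sqinter> \<c> j" using j by (simp add: le_meet_iff)
  moreover have "j \<sqinter> \<c> j \<sqsubseteq> partner j \<squnion> \<c> (partner j)"
    using j by (simp add: kleene)
  moreover have "partner j \<squnion> \<c> (partner j) \<sqsubseteq> \<c> (partner j)"
    using p by (simp add: join_le_iff)
  ultimately have "j \<sqsubseteq> \<c> (partner j)"
    using j by (meson cpl_closed join_closed join_primes_closed le_trans meet_closed partner_closed)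
  then show False using j by (simp add: prime_le_cpl_iff)
qed

text \<open>
  As \<open>j\<close> lies below \<open>a \<squnion> r = \<top>\<close> and is prime, it is below \<open>a\<close> or below the weak complement \<open>r\<close>
  of \<open>a\<close>.
\<close>

lemma prime_not_le_imp_meet_le_cpl:
  assumes j: "j \<in> join_primes A" and [simp]: "a \<in> carrier A" and nle: "\<not> j \<sqsubseteq> a"
  shows "a \<sqinter> j \<sqsubseteq> \<c> a"
proof -
  obtain r where r [simp]: "r \<in> carrier A" and ar: "a \<squnion> r = \<top>" "a \<sqinter> r \<sqsubseteq> \<c> a"
    using weak_complement_exists[of a] by auto
  have "j \<sqsubseteq> \<Squnion> {a, r}" using j ar by (simp flip: join_def)
  then have "j \<sqsubseteq> r" using join_primeD[OF j, of "{a, r}"] nle by auto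
  then show ?thesis
    using j by - (rule le_sandwich[OF ar(2)], simp_all add: le_meet_iff meet_leI2 meet_left)
qed

text \<open>
  Since \<open>j\<close> is not below \<open>k\<close>, the dichotomy for \<open>j\<close> gives \<open>k \<sqsubseteq> \<c> k\<close>, and then the Kleene law puts
  \<open>k\<close> below \<open>partner j \<squnion> \<c> (partner j)\<close>. The second term is cut away by the same dichotomy,
  applied to \<open>\<c> (partner j)\<close>: together with \<open>j\<close>, and hence with \<open>k\<close>, it is below \<open>partner j\<close>.
\<close>

lemma below_prime_le_partner:
  assumes j: "j \<in> join_primes A" and k: "k \<in> join_primes A" and kj: "k \<sqsubseteq> j" "k \<noteq> j"
  shows "k \<sqsubseteq> partner j"
proof (rule cut[where x = "\<c> (partner j)"])
  have [simp]: "j \<in> carrier A" "k \<in> carrier A" using j k by auto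
  have "\<not> j \<sqsubseteq> k" by (metis j k join_primes_closed kj le_antisym)
  then have "k \<sqinter> j \<sqsubseteq> \<c> k" using prime_not_le_imp_meet_le_cpl[OF j] by simp
  then have "k \<sqsubseteq> k \<sqinter> \<c> k"
    using kj by (simp add: le_meet_iff le_trans[of k "k \<sqinter> j" "\<c> k"])
  moreover have "k \<sqinter> \<c> k \<sqsubseteq> partner j \<squnion> \<c> (partner j)"
    by (simp add: kleene)
  ultimately show "k \<sqsubseteq> partner j \<squnion> \<c> (partner j)"
    by (meson \<open>k \<in> carrier A\<close> cpl_closed join_closed le_trans meet_closed partner_closed)
  have "\<not> j \<sqsubseteq> \<c> (partner j)" using j by (simp add: prime_le_cpl_iff)
  then have "\<c> (partner j) \<sqinter> j \<sqsubseteq> partner j"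
    using prime_not_le_imp_meet_le_cpl[OF j, of "\<c> (partner j)"] by (simp add: cpl_cpl)
  then show "k \<sqinter> \<c> (partner j) \<sqsubseteq> partner j"
    using kj by - (rule le_sandwich, assumption, simp_all add: lattice_simps lattice_intros)
qed (use k in auto)

text \<open>
  The reverse inequality is the previous lemma for the pair \<open>partner j \<sqsubseteq> partner k\<close>.
\<close>

lemma below_prime_eq_partner:
  assumes j: "j \<in> join_primes A" and k: "k \<in> join_primes A" and kj: "k \<sqsubseteq> j" "k \<noteq> j"
  shows "k = partner j"
proof (rule le_antisym)
  show "k \<sqsubseteq> partner j" using assms by (rule below_prime_le_partner)
  have "partner j \<noteq> partner k" using j k kj(2) by (metis partner_partner)
  then show "partner j \<sqsubseteq> k"
    using below_prime_le_partner[of "partner k" "partner j"] partner_antitone[OF j k kj(1)] j k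
    by simp
qed (use k in auto)

end


section \<open>The representation by rough sets\<close>

lemma partial_order_rough_set_algebra: "partial_order (rough_set_algebra U R)"
  by unfold_locales (simp_all add: rough_set_algebra_def prod_eq_iff subset_antisym, blast+)

text \<open>
  Joins, meets and bounds are determined by the order, so an order isomorphism preserves them;
  this also shows that they exist in \<open>B\<close>.
\<close>

lemma dm_isoI:
  fixes A :: "('a, 'm) dm_alg_scheme" and B :: "('b, 'n) dm_alg_scheme"
  assumes "bounded_lattice A" and "partial_order B"
    and bij: "bij_betw h (carrier A) (carrier B)"
    and le: "\<And>x y. \<lbrakk>x \<in> carrier A; y \<in> carrier A\<rbrakk> \<Longrightarrow> h x \<sqsubseteq>\<^bsub>B\<^esub> h y \<longleftrightarrow> x \<sqsubseteq>\<^bsub>A\<^esub> y"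
    and cpl: "\<And>x. x \<in> carrier A \<Longrightarrow> h (\<c>\<^bsub>A\<^esub> x) = \<c>\<^bsub>B\<^esub> (h x)"
  shows "dm_iso A B"
proof -
  interpret A: bounded_lattice A by fact
  interpret B: partial_order B by fact
  have carrier_B: "carrier B = h ` carrier A" using bij by (simp add: bij_betw_def)
  have Upper: "Upper B (h ` X) = h ` Upper A X" if "X \<subseteq> carrier A" for X
  proof -
    have "u \<in> Upper B (h ` X) \<longleftrightarrow> u \<in> carrier B \<and> (\<forall>x\<in>X. h x \<sqsubseteq>\<^bsub>B\<^esub> u)" for u
      using that by (auto simp: Upper_def carrier_B)
    moreover have "v \<in> Upper A X \<longleftrightarrow> v \<in> carrier A \<and> (\<forall>x\<in>X. h x \<sqsubseteq>\<^bsub>B\<^esub> h v)" for v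
      using that by (auto simp: Upper_def le subset_iff)
    ultimately show ?thesis
      by (auto simp: carrier_B)
  qed
  have Lower: "Lower B (h ` X) = h ` Lower A X" if "X \<subseteq> carrier A" for X
  proof -
    have "u \<in> Lower B (h ` X) \<longleftrightarrow> u \<in> carrier B \<and> (\<forall>x\<in>X. u \<sqsubseteq>\<^bsub>B\<^esub> h x)" for u
      using that by (auto simp: Lower_def carrier_B)
    moreover have "v \<in> Lower A X \<longleftrightarrow> v \<in> carrier A \<and> (\<forall>x\<in>X. h v \<sqsubseteq>\<^bsub>B\<^esub> h x)" for v
      using that by (auto simp: Lower_def le subset_iff)
    ultimately show ?thesis
      by (auto simp: carrier_B)
  qed
  have least: "(SOME y. least B y (h ` X)) = h x" if "least A x X" for x X
  proof -
    have "least B (h x) (h ` X)"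
      using that carrier_B by (auto simp: least_def le subset_iff)
    then show ?thesis by (metis B.least_unique someI_ex)
  qed
  have greatest: "(SOME y. greatest B y (h ` X)) = h x" if "greatest A x X" for x X
  proof -
    have "greatest B (h x) (h ` X)"
      using that carrier_B by (auto simp: greatest_def le subset_iff)
    then show ?thesis by (metis B.greatest_unique someI_ex)
  qed
  have "h (x \<squnion>\<^bsub>A\<^esub> y) = h x \<squnion>\<^bsub>B\<^esub> h y" if "x \<in> carrier A" "y \<in> carrier A" for x y
    using that least[OF A.sup_of_two_least[OF that]] Upper[of "{x, y}"]
    by (simp add: join_def sup_def[of B])
  moreover have "h (x \<sqinter>\<^bsub>A\<^esub> y) = h x \<sqinter>\<^bsub>B\<^esub> h y" if "x \<in> carrier A" "y \<in> carrier A" for x y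
    using that greatest[OF A.inf_of_two_greatest[OF that]] Lower[of "{x, y}"]
    by (simp add: meet_def inf_def[of B])
  moreover have "h \<bottom>\<^bsub>A\<^esub> = \<bottom>\<^bsub>B\<^esub>"
    using least[OF A.bottom_least] by (simp add: bottom_def[of B] carrier_B)
  moreover have "h \<top>\<^bsub>A\<^esub> = \<top>\<^bsub>B\<^esub>"
    using greatest[OF A.top_greatest] by (simp add: top_def[of B] carrier_B)
  ultimately show ?thesis
    using bij cpl unfolding dm_iso_def by blast
qed

context algebraic_three_valued_algebra
begin

definition partner_rel :: "'a rel" where
  "partner_rel = {(j, k). j \<in> join_primes A \<and> k \<in> {j, partner j}}"

definition primes_below :: "'a \<Rightarrow> 'a set" where
  "primes_below x = {j \<in> join_primes A. j \<sqsubseteq> x}"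

lemma equiv_partner_rel: "equiv (join_primes A) partner_rel"
  by (auto simp: equiv_def refl_on_def sym_def trans_def partner_rel_def)

lemma rough_set_partner_rel:
  "rough_set (join_primes A) partner_rel X =
     ({j \<in> join_primes A. j \<in> X \<and> partner j \<in> X}, {j \<in> join_primes A. j \<in> X \<or> partner j \<in> X})"
proof -
  have "nbhd (join_primes A) partner_rel j = {j, partner j}" if "j \<in> join_primes A" for j
    using that by (auto simp: nbhd_def partner_rel_def)
  then show ?thesis
    by (auto simp: rough_set_def lower_approx_def upper_approx_def)
qed

abbreviation (input) rough_algebra :: "('a set \<times> 'a set) dm_alg" where
  "rough_algebra \<equiv> rough_set_algebra (join_primes A) partner_rel"

definition represent :: "'a \<Rightarrow> 'a set \<times> 'a set" where
  "represent x = rough_set (join_primes A) partner_rel (primes_below x)"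

text \<open>
  Whether a prime \<open>j\<close> lies below \<open>x\<close> can be read off the rough set: from the lower approximation
  if \<open>j\<close> is the greatest element of its class, from the upper one if it is the least.
\<close>

lemma represent_le_iff:
  assumes x [simp]: "x \<in> carrier A" and y [simp]: "y \<in> carrier A"
  shows "represent x \<sqsubseteq>\<^bsub>rough_algebra\<^esub> represent y \<longleftrightarrow> x \<sqsubseteq> y"
proof
  assume le: "represent x \<sqsubseteq>\<^bsub>rough_algebra\<^esub> represent y"
  have "j \<sqsubseteq> y" if j: "j \<in> join_primes A" and jx: "j \<sqsubseteq> x" for j
  proof (cases "partner j \<sqsubseteq> j")
    case True
    then have "partner j \<sqsubseteq> x" using j jx by (meson join_primes_closed le_trans partner_closed x)
    then have "j \<in> fst (represent x)"
      using j jx by (simp add: represent_def rough_set_partner_rel primes_below_def)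
    then have "j \<in> fst (represent y)" using le by (auto simp: rough_set_algebra_def)
    then show ?thesis by (simp add: represent_def rough_set_partner_rel primes_below_def)
  next
    case False
    then have jp: "j \<sqsubseteq> partner j" using partner_comparable j by auto
    have "j \<in> snd (represent x)"
      using j jx by (simp add: represent_def rough_set_partner_rel primes_below_def)
    then have "j \<in> snd (represent y)" using le by (auto simp: rough_set_algebra_def)
    then have "j \<sqsubseteq> y \<or> partner j \<sqsubseteq> y"
      by (auto simp: represent_def rough_set_partner_rel primes_below_def)
    then show ?thesis using jp j by (meson join_primes_closed le_trans partner_closed y)
  qed
  then show "x \<sqsubseteq> y" using join_primes_dense[OF x y] by blast
next
  assume le: "x \<sqsubseteq> y"
  have "primes_below x \<subseteq> primes_below y"
    using le by (auto simp: primes_below_def intro: le_trans[OF _ le])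
  then show "represent x \<sqsubseteq>\<^bsub>rough_algebra\<^esub> represent y"
    by (auto simp: represent_def rough_set_partner_rel rough_set_algebra_def)
qed

text \<open>
  The set \<open>X\<close> may contain just the greatest element of a two-element class. The set \<open>?D\<close>
  keeps the rough set of \<open>X\<close> but takes the least element in that case. It is then a down-set, because
  comparable primes lie in the same class, and so it consists of all primes below its join.
\<close>

lemma represent_surj:
  assumes X: "X \<subseteq> join_primes A"
  shows "\<exists>x\<in>carrier A. represent x = rough_set (join_primes A) partner_rel X"
proof -
  let ?D = "{j \<in> join_primes A. (j \<in> X \<or> partner j \<in> X) \<and>
    (partner j \<sqsubseteq> j \<longrightarrow> j \<in> X \<and> partner j \<in> X)}"
  have DA: "?D \<subseteq> carrier A" by auto
  have "primes_below (\<Squnion> ?D) = ?D"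
  proof
    show "?D \<subseteq> primes_below (\<Squnion> ?D)"
      using sup_upper[OF DA] by (auto simp: primes_below_def)
    show "primes_below (\<Squnion> ?D) \<subseteq> ?D"
    proof
      fix j assume "j \<in> primes_below (\<Squnion> ?D)"
      then have j: "j \<in> join_primes A" and le: "j \<sqsubseteq> \<Squnion> ?D" by (auto simp: primes_below_def)
      from join_primeD[OF j DA le] obtain d where d: "d \<in> ?D" "j \<sqsubseteq> d" by auto
      show "j \<in> ?D"
      proof (cases "j = d")
        case False
        then have jd: "j = partner d" using d j by (intro below_prime_eq_partner) auto
        have "\<not> d \<sqsubseteq> j" using False d j le_antisym[of j d] join_primes_closed
          by blast
        then show ?thesis using d jd j by auto
      qed (use d in simp)
    qed
  qed
  moreover have "rough_set (join_primes A) partner_rel ?D = rough_set (join_primes A) partner_rel X"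
  proof -
    have cases: "j \<sqsubseteq> partner j \<and> \<not> partner j \<sqsubseteq> j \<or> partner j \<sqsubseteq> j \<and> \<not> j \<sqsubseteq> partner j \<or> partner j = j"
      if "j \<in> join_primes A" for j
      using that by (metis join_primes_closed le_antisym partner_closed partner_comparable)
    have "j \<in> ?D \<and> partner j \<in> ?D \<longleftrightarrow> j \<in> X \<and> partner j \<in> X"
      "j \<in> ?D \<or> partner j \<in> ?D \<longleftrightarrow> j \<in> X \<or> partner j \<in> X" if "j \<in> join_primes A" for j
      using that cases[OF that] by auto
    then show ?thesis unfolding rough_set_partner_rel by blast
  qed
  ultimately show ?thesis
    using DA by (intro bexI[of _ "\<Squnion> ?D"]) (simp_all add: represent_def)
qed

text \<open>
  The primes below \<open>\<c> x\<close> are those whose partner is not below \<open>x\<close>. As classes are closed under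
  partners, the approximations do not distinguish this set from the complement of
  \<open>primes_below x\<close>.
\<close>

lemma represent_cpl:
  assumes x: "x \<in> carrier A"
  shows "represent (\<c> x) = \<c>\<^bsub>rough_algebra\<^esub> (represent x)"
proof -
  have "\<c>\<^bsub>rough_algebra\<^esub> (represent x) =
      rough_set (join_primes A) partner_rel (join_primes A - primes_below x)"
    unfolding represent_def by (rule cpl_rough_set_algebra) (auto simp: primes_below_def)
  also have "\<dots> = represent (\<c> x)"
    using x by (auto simp: represent_def rough_set_partner_rel primes_below_def prime_le_cpl_iff)
  finally show ?thesis ..
qed

lemma dm_iso_rough_set_algebra: "dm_iso A rough_algebra"
proof (rule dm_isoI[where h = represent])
  show "bounded_lattice A" ..
  show "partial_order rough_algebra" by (rule partial_order_rough_set_algebra)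
  show "represent x \<sqsubseteq>\<^bsub>rough_algebra\<^esub> represent y \<longleftrightarrow> x \<sqsubseteq> y"
    if "x \<in> carrier A" "y \<in> carrier A" for x y
    using that by (rule represent_le_iff)
  show "represent (\<c> x) = \<c>\<^bsub>rough_algebra\<^esub> (represent x)" if "x \<in> carrier A" for x
    using that by (rule represent_cpl)
  have carrier_eq: "carrier rough_algebra =
      {rough_set (join_primes A) partner_rel X | X. X \<subseteq> join_primes A}"
    by (simp add: rough_set_algebra_def)
  show "bij_betw represent (carrier A) (carrier rough_algebra)"
    unfolding bij_betw_def
  proof
    show "inj_on represent (carrier A)"
    proof (rule inj_onI)
      fix x y assume xy: "x \<in> carrier A" "y \<in> carrier A" "represent x = represent y"
      have "z \<sqsubseteq>\<^bsub>rough_algebra\<^esub> z" for z by (simp add: rough_set_algebra_def)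
      then have "x \<sqsubseteq> y" "y \<sqsubseteq> x"
        using xy represent_le_iff[of x y] represent_le_iff[of y x] by simp_all
      then show "x = y" using xy le_antisym by simp
    qed
    show "represent ` carrier A = carrier rough_algebra"
    proof
      have "primes_below x \<subseteq> join_primes A" for x by (auto simp: primes_below_def)
      then show "represent ` carrier A \<subseteq> carrier rough_algebra"
        unfolding carrier_eq represent_def by blast
      show "carrier rough_algebra \<subseteq> represent ` carrier A"
      proof
        fix p assume "p \<in> carrier rough_algebra"
        then obtain X where "X \<subseteq> join_primes A" "p = rough_set (join_primes A) partner_rel X"
          unfolding carrier_eq by blast
        with represent_surj[of X] show "p \<in> represent ` carrier A"
          by (simp add: image_iff) metis
      qed
    qed
  qed
qed

end

theorem corollary5p2:
  fixes A :: "('a, 'm) dm_alg_scheme"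
  assumes "semisimple_nelson_algebra TYPE('i) TYPE('b) A"
    and "algebraic_lattice A"
  shows "\<exists>(U :: 'a set) (R :: 'a rel). equiv U R \<and> dm_iso A (rough_set_algebra U R)"
proof -
  interpret nelson_algebra A
    using assms(1) by (simp add: semisimple_nelson_algebra_def)
  interpret algebraic_lattice A by fact
  interpret algebraic_three_valued_algebra A
  proof
    fix a assume a: "a \<in> carrier A"
    have "a \<sqinter>\<^bsub>A\<^esub> nelson_imp A a \<bottom>\<^bsub>A\<^esub> \<sqsubseteq>\<^bsub>A\<^esub> \<c>\<^bsub>A\<^esub> a \<squnion>\<^bsub>A\<^esub> \<bottom>\<^bsub>A\<^esub>"
      using a le_imp_iff[of a "\<bottom>\<^bsub>A\<^esub>" "nelson_imp A a \<bottom>\<^bsub>A\<^esub>"] by simp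
    then have "a \<sqinter>\<^bsub>A\<^esub> nelson_imp A a \<bottom>\<^bsub>A\<^esub> \<sqsubseteq>\<^bsub>A\<^esub> \<c>\<^bsub>A\<^esub> a"
      by (rule le_sandwich) (use a in \<open>simp_all add: lattice_simps\<close>)
    then show "\<exists>r\<in>carrier A. a \<squnion>\<^bsub>A\<^esub> r = \<top>\<^bsub>A\<^esub> \<and> a \<sqinter>\<^bsub>A\<^esub> r \<sqsubseteq>\<^bsub>A\<^esub> \<c>\<^bsub>A\<^esub> a"
      using semisimple_join_imp_bottom[OF assms(1) a] a by blast
  qed
  show ?thesis
    using equiv_partner_rel dm_iso_rough_set_algebra by blast
qed

end
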